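(* Let $n$ be a non-negative integer and $\gamma$ a real number with $\gamma\ge n$. Then the polynomial $G_n^\gamma(x)=F(-n,\gamma-n+1,-\gamma;-x)$ is unitary, i.e. every complex root of $G_n^\gamma(x)$ lies on the unit circle $\{z\in\mathbb{C}:|z|=1\}$. Furthermore, for any non-negative integer $m$: $G_{2m}^\gamma(1)\ne0$ for every real $\gamma\ge 2m$, and $G_{2m+1}^\gamma(1)=0$ for every real $\gamma\ge 2m+1$.
   Context: $F(-n,b,c;x)=1+\sum_{k=1}^n\frac{(-n)_k(b)_k}{(c)_k}\frac{x^k}{k!}$ is the Gaussian hypergeometric polynomial, where $(a)_k=a(a+1)\cdots(a+k-1)$; for $n=0$ it is the constant $1$. *)

theory Defs
  imports Complex_Main "HOL-Computational_Algebra.Polynomial"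
begin

text \<open>
  \<open>hyp_poly n b c\<close> is the polynomial \<open>F(-n, b, c; x)\<close> in \<open>x\<close>. It is meaningful when
  \<open>pochhammer c k \<noteq> 0\<close> for \<open>1 \<le> k \<le> n\<close>; for \<open>c = -\<gamma>\<close> this follows from \<open>\<gamma> \<ge> n\<close>.
\<close>
definition hyp_poly :: "nat \<Rightarrow> real \<Rightarrow> real \<Rightarrow> real poly" where
  "hyp_poly n b c =
     1 + (\<Sum>k = 1..n. monom (pochhammer (- real n) k * pochhammer b k
                              / pochhammer c k / fact k) k)"

definition G :: "nat \<Rightarrow> real \<Rightarrow> real poly" where
  "G n \<gamma> = pcompose (hyp_poly n (\<gamma> - real n + 1) (- \<gamma>)) [:0, -1:]"

definition unitary_poly :: "real poly \<Rightarrow> bool" where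
  "unitary_poly p \<longleftrightarrow> (\<forall>z::complex. poly (map_poly complex_of_real p) z = 0 \<longrightarrow> cmod z = 1)"

end

theory Submission
  imports Defs
begin

text \<open>
  With \<open>\<lambda> = \<gamma> - n + 1 \<ge> 1\<close>, the polynomial \<open>G n \<gamma>\<close> at \<open>-x\<close> is a multiple of the \<open>n\<close>-th
  Taylor coefficient \<open>P\<^sub>n(x)\<close> in \<open>t\<close> of \<open>((1 - t) (1 - x t))\<close> to the power \<open>-\<lambda>\<close>, and
  \<open>P\<^sub>n(w\<^sup>2) = w\<^sup>n C\<^sub>n(y)\<close>, where \<open>C\<^sub>n\<close> is the Gegenbauer polynomial of parameter \<open>\<lambda>\<close>
  and \<open>2 y = w + 1/w\<close>. The three-term recurrence shows that
  \<open>Im (C\<^sub>n(y) cnj (C\<^sub>n\<^sub>-\<^sub>1(y)))\<close> has the sign of \<open>Im y\<close>, so \<open>C\<^sub>n\<close> has no nonreal zero.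
  If \<open>y\<close> is real, then \<open>w\<close> is real or \<open>\<bar>w\<bar> = 1\<close>, and \<open>P\<^sub>n\<close> is positive at \<open>w\<^sup>2 > 0\<close>.
  At \<open>x = -1\<close> the recurrence links \<open>P\<^sub>n\<close> to \<open>P\<^sub>n\<^sub>-\<^sub>2\<close>.
\<close>

text \<open>The Cauchy product of the binomial series of the two factors. The general field lets one
  definition serve both real positivity and complex roots.\<close>

definition gegen :: "'a::field_char_0 \<Rightarrow> nat \<Rightarrow> 'a poly" where
  "gegen l n = (\<Sum>k\<le>n. monom (pochhammer l k / fact k * (pochhammer l (n - k) / fact (n - k))) k)"

lemma coeff_gegen:
  "coeff (gegen l n) k =
    (if k \<le> n then pochhammer l k / fact k * (pochhammer l (n - k) / fact (n - k)) else 0)"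
  by (simp add: gegen_def coeff_sum)

lemma poly_gegen:
  "poly (gegen l n) x =
    (\<Sum>k\<le>n. pochhammer l k / fact k * (pochhammer l (n - k) / fact (n - k)) * x ^ k)"
  by (simp add: gegen_def poly_sum poly_monom)

lemma pochhammer_Suc_div_fact:
  "pochhammer l (Suc k) / fact (Suc k) = (l + of_nat k) / of_nat (Suc k) * (pochhammer l k / fact k)"
  for l :: "'a::field_char_0"
  by (simp add: pochhammer_Suc)

text \<open>The generating function f satisfies (1 - t) (1 - x t) f' = l (1 + x - 2 x t) f; compare
  coefficients of t^(n+1). The proof checks this coefficient by coefficient in x.\<close>

lemma gegen_rec:
  fixes l :: "'a::field_char_0"
  shows "smult (of_nat (n + 2)) (gegen l (n + 2)) =
    smult (of_nat n + 1 + l) (gegen l (n + 1) + pCons 0 (gegen l (n + 1)))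
      - smult (of_nat n + 2 * l) (pCons 0 (gegen l n))"
proof (rule poly_eqI)
  fix k
  define u where "u k = pochhammer l k / fact k" for k
  have u_Suc: "of_nat (Suc k) * u (Suc k) = (l + of_nat k) * u k" for k
    unfolding u_def pochhammer_Suc_div_fact using of_nat_neq_0[of k, where 'a='a] by simp
  have c: "coeff (gegen l n) k = (if k \<le> n then u k * u (n - k) else 0)" for n k
    by (simp add: coeff_gegen u_def)
  have u0: "u 0 = 1" by (simp add: u_def)
  \<comment> \<open>The last case is 1 <= k <= n + 1, where every coefficient reduces to a multiple
    of \<open>u i * u j\<close>.\<close>
  consider "k = 0" | "k = n + 2" | "k > n + 2" | i j where "k = Suc i" "n = i + j"
    by (metis One_nat_def Suc_leI add_2_eq_Suc' le_Suc_ex less_Suc_eq_le linorder_neqE_nat not0_implies_Suc not_less_eq)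
  then show "coeff (smult (of_nat (n + 2)) (gegen l (n + 2))) k = coeff
    (smult (of_nat n + 1 + l) (gegen l (n + 1) + pCons 0 (gegen l (n + 1)))
      - smult (of_nat n + 2 * l) (pCons 0 (gegen l n))) k"
  proof cases
    case 1
    then show ?thesis using u_Suc[of "Suc n"] by (simp add: c u0 algebra_simps)
  next
    case 2
    then show ?thesis using u_Suc[of "Suc n"] by (simp add: c u0 algebra_simps)
  next
    case 3
    then show ?thesis by (cases k) (simp_all add: c)
  next
    case (4 i j)
    have ui: "u (Suc i) = (l + of_nat i) * u i / of_nat (Suc i)"
      and uj: "u (Suc j) = (l + of_nat j) * u j / of_nat (Suc j)"
      using u_Suc[of i] u_Suc[of j] of_nat_neq_0[of i, where 'a='a] of_nat_neq_0[of j, where 'a='a]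
      by (simp_all add: eq_divide_eq mult.commute)
    have nz: "1 + of_nat i \<noteq> (0::'a)" "1 + of_nat j \<noteq> (0::'a)"
      using of_nat_neq_0[of i, where 'a='a] of_nat_neq_0[of j, where 'a='a] by simp_all
    have "of_nat (i + j + 2) * (u (Suc i) * u (Suc j)) =
       (of_nat (i + j) + 1 + l) * (u (Suc i) * u j + u i * u (Suc j))
         - (of_nat (i + j) + 2 * l) * (u i * u j)"
      unfolding ui uj using nz by (simp add: divide_simps) algebra
    then show ?thesis
      using 4 by (simp add: c Suc_diff_le)
  qed
qed

lemma poly_gegen_rec:
  "of_nat (n + 2) * poly (gegen l (n + 2)) x =
    (of_nat n + 1 + l) * (1 + x) * poly (gegen l (n + 1)) x
      - (of_nat n + 2 * l) * x * poly (gegen l n) x"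
  using arg_cong[OF gegen_rec[of n l], of "\<lambda>p. poly p x"]
  by (simp add: algebra_simps)

lemma gegen_0 [simp]: "gegen l 0 = 1"
  by (simp add: gegen_def)

lemma gegen_1: "gegen l (Suc 0) = [:l, l:]"
  by (simp add: gegen_def monom_altdef)

text \<open>The factor 1 + x kills the middle term, leaving (n + 2) P(n+2) = (n + 2 l) P(n) at -1
  with nonzero factors, so vanishing depends only on the parity of n.\<close>

lemma gegen_neg_one:
  fixes l :: real
  assumes "l > 0"
  shows "poly (gegen l (2 * m)) (- 1) \<noteq> 0 \<and> poly (gegen l (2 * m + 1)) (- 1) = 0"
proof (induction m)
  case 0
  show ?case by (simp add: gegen_1)
next
  case (Suc m)
  from poly_gegen_rec[of "2 * m" l "-1"] poly_gegen_rec[of "2 * m + 1" l "-1"] Suc assms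
  show ?case by (auto simp: add_ac)
qed

lemma gegen_nonzero:
  fixes w :: complex and l :: real
  assumes "l > 0" "w \<noteq> 0" and im: "Im (w + 1 / w) \<noteq> 0"
  shows "poly (gegen (of_real l) n) (w\<^sup>2) \<noteq> 0"
proof -
  define C where "C n = poly (gegen (of_real l) n) (w\<^sup>2) / w ^ n" for n
  \<comment> \<open>This is twice the Gegenbauer variable, so that 1 + w^2 = w y; the sign of the
    imaginary part is the same.\<close>
  define y where "y = w + 1 / w"
  have rec: "of_nat (n + 2) * C (n + 2) =
      (of_nat n + 1 + of_real l) * y * C (n + 1) - (of_nat n + 2 * of_real l) * C n" for n
  proof -
    have "of_nat (n + 2) * C (n + 2) =
       ((of_nat n + 1 + of_real l) * (1 + w\<^sup>2) * poly (gegen (of_real l) (n + 1)) (w\<^sup>2)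
      - (of_nat n + 2 * of_real l) * w\<^sup>2 * poly (gegen (of_real l) n) (w\<^sup>2)) / w ^ (n + 2)"
      unfolding C_def poly_gegen_rec[symmetric] by simp
    also have "\<dots> = (of_nat n + 1 + of_real l) * y * C (n + 1) - (of_nat n + 2 * of_real l) * C n"
      using \<open>w \<noteq> 0\<close> unfolding C_def y_def
      by (simp add: divide_simps power2_eq_square)
    finally show ?thesis .
  qed
  \<comment> \<open>The factor \<open>Im y\<close> treats both half-planes at once. Multiply
    \<open>rec\<close> by \<open>cnj (C (n + 1))\<close>: since Im (C(n) cnj C(n+1)) = - Im (C(n+1)
    cnj C(n)), the minus sign in \<open>rec\<close> turns into a plus, and both terms have positive
    real coefficients or squares.\<close>
  have wronskian: "Im y * Im (C (Suc n) * cnj (C n)) > 0" for n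
  proof (induction n)
    case 0
    have "C (Suc 0) * cnj (C 0) = of_real l * y"
      using \<open>w \<noteq> 0\<close> by (simp add: C_def y_def gegen_1 field_simps power2_eq_square)
    then show ?case using assms by (auto simp: y_def[symmetric] zero_less_mult_iff mult_less_0_iff)
  next
    case (Suc n)
    have "of_nat (n + 2) * C (n + 2) * cnj (C (n + 1)) =
      (of_nat n + 1 + of_real l) * y * (C (n + 1) * cnj (C (n + 1)))
        - (of_nat n + 2 * of_real l) * (C n * cnj (C (n + 1)))"
      unfolding rec by (simp add: algebra_simps)
    also have "\<dots> = of_real ((real n + 1 + l) * (cmod (C (n + 1)))\<^sup>2) * y
        - of_real (real n + 2 * l) * (C n * cnj (C (n + 1)))"
      by (simp add: complex_norm_square del: of_real_power)
    finally have "Im (of_real (real (n + 2)) * (C (n + 2) * cnj (C (n + 1)))) =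
      Im (of_real ((real n + 1 + l) * (cmod (C (n + 1)))\<^sup>2) * y
        - of_real (real n + 2 * l) * (C n * cnj (C (n + 1))))"
      by (simp add: mult.assoc)
    moreover have Im_of_real_mult: "Im (of_real a * v) = a * Im v" for a v
      by simp
    ultimately have "real (n + 2) * Im (C (n + 2) * cnj (C (n + 1))) =
       (real n + 1 + l) * (cmod (C (n + 1)))\<^sup>2 * Im y
        + (real n + 2 * l) * Im (C (n + 1) * cnj (C n))"
      unfolding minus_complex.sel Im_of_real_mult by (simp add: algebra_simps)
    then have "real (n + 2) * (Im y * Im (C (n + 2) * cnj (C (n + 1)))) =
       (real n + 1 + l) * (cmod (C (n + 1)))\<^sup>2 * (Im y)\<^sup>2
        + (real n + 2 * l) * (Im y * Im (C (n + 1) * cnj (C n)))"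
      by algebra
    also have "\<dots> > 0"
      using Suc[folded Suc_eq_plus1] \<open>l > 0\<close>
      by (intro add_nonneg_pos mult_pos_pos[of "real n + 2 * l"] mult_nonneg_nonneg)
        (simp_all del: times_complex.sel)
    finally have "0 < real (n + 2) * (Im y * Im (C (n + 2) * cnj (C (n + 1))))" .
    then have "0 < Im y * Im (C (n + 2) * cnj (C (n + 1)))"
      by (rule zero_less_mult_pos) simp
    then show ?case by (simp only: add_2_eq_Suc' Suc_eq_plus1[symmetric])
  qed
  have "C n \<noteq> 0" using wronskian[of n] by auto
  then show ?thesis by (simp add: C_def)
qed

lemma gegen_pos:
  fixes l x :: real
  assumes "l > 0" "x \<ge> 0"
  shows "poly (gegen l n) x > 0"
proof -
  \<comment> \<open>All terms are nonnegative; the constant one is positive even at x = 0.\<close>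
  have "(\<Sum>k\<in>{0}. pochhammer l k / fact k * (pochhammer l (n - k) / fact (n - k)) * x ^ k)
    \<le> poly (gegen l n) x"
    unfolding poly_gegen using assms
    by (intro sum_mono2) (auto intro!: mult_nonneg_nonneg pochhammer_nonneg divide_nonneg_nonneg)
  moreover have "pochhammer l n > 0" using assms by (intro pochhammer_pos)
  then have "pochhammer l n / fact n > 0" by simp
  ultimately show ?thesis by simp
qed

lemma map_poly_gegen: "map_poly of_real (gegen l n) = gegen (of_real l :: complex) n"
  by (rule poly_eqI) (simp add: coeff_map_poly coeff_gegen pochhammer_of_real)

lemma poly_gegen_of_real: "poly (gegen (of_real l :: complex) n) (of_real x) = of_real (poly (gegen l n) x)"
  by (simp add: poly_gegen pochhammer_of_real)

lemma gegen_root_unit: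
  fixes z :: complex and l :: real
  assumes "l > 0" and root: "poly (gegen (of_real l) n) z = 0"
  shows "cmod z = 1"
proof (rule ccontr)
  assume nz: "cmod z \<noteq> 1"
  define w where "w = csqrt z"
  have z: "z = w\<^sup>2" by (simp add: w_def)
  have pos: "z \<noteq> of_real x" if "x \<ge> 0" for x
    using root gegen_pos[OF \<open>l > 0\<close> that, of n] by (auto simp: poly_gegen_of_real)
  have "w \<noteq> 0" using pos[of 0] z by auto
  have "Im w \<noteq> 0"
    using pos[of "(Re w)\<^sup>2"] z by (auto simp: complex_eq_iff power2_eq_square)
  moreover have "cmod w \<noteq> 1" using nz by (auto simp: z norm_power)
  \<comment> \<open>Hence w + 1/w is real only if w is real or on the unit circle, both
    excluded.\<close>
  moreover have "Im (w + 1 / w) = Im w * (1 - 1 / (cmod w)\<^sup>2)"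
    by (simp add: Im_divide cmod_power2 algebra_simps)
  ultimately have "Im (w + 1 / w) \<noteq> 0"
    using \<open>w \<noteq> 0\<close> by (auto simp: power2_eq_1_iff) (smt (verit) norm_ge_zero)
  then show False using gegen_nonzero[OF \<open>l > 0\<close> \<open>w \<noteq> 0\<close>] root z by blast
qed

text \<open>The signs in (-n)_k / (-\<gamma>)_k cancel, leaving (n-k+1)_k / (\<gamma>-k+1)_k. As l +
  n - k = \<gamma> - k + 1, this equals (n! / (n-k)!) (l)_(n-k) / (l)_n.\<close>

lemma hyp_poly_eq_gegen:
  assumes "real n \<le> \<gamma>"
  defines "l \<equiv> \<gamma> - real n + 1"
  shows "hyp_poly n l (- \<gamma>) = smult (fact n / pochhammer l n) (gegen l n)"
proof (rule poly_eqI)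
  fix k
  have l: "pochhammer l k > 0" for k
    using assms by (intro pochhammer_pos) auto
  have "coeff (hyp_poly n l (- \<gamma>)) k = (if k \<le> n then
     pochhammer (- real n) k * pochhammer l k / pochhammer (- \<gamma>) k / fact k else 0)"
    by (cases k) (auto simp: hyp_poly_def coeff_sum)
  also have "\<dots> = coeff (smult (fact n / pochhammer l n) (gegen l n)) k"
  proof (cases "k \<le> n")
    case True
    have "fact n = fact (n - k) * pochhammer (real n - real k + 1) k"
      using pochhammer_product[of "n - k" n "1::real"] True
      by (simp add: pochhammer_fact of_nat_diff algebra_simps)
    moreover have "pochhammer l n = pochhammer l (n - k) * pochhammer (\<gamma> - real k + 1) k"
      using pochhammer_product[of "n - k" n l] True
      by (simp add: l_def of_nat_diff algebra_simps)
    moreover from this have "pochhammer (\<gamma> - real k + 1) k \<noteq> 0"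
      using l[of n] by auto
    ultimately show ?thesis
      using True l[of "n - k"] by (simp add: pochhammer_minus coeff_gegen field_simps)
  qed (simp add: coeff_gegen)
  finally show "coeff (hyp_poly n l (- \<gamma>)) k = coeff (smult (fact n / pochhammer l n) (gegen l n)) k" .
qed

lemma map_poly_pcompose_uminus:
  "map_poly of_real (pcompose p [:0, -1:]) = pcompose (map_poly of_real p) [:0, -1 :: complex:]"
proof -
  \<comment> \<open>In monomial form, composition just multiplies the k-th coefficient by
    (-1)^k.\<close>
  have "[:0, -1 :: real:] = monom (- 1) (Suc 0)" "[:0, -1 :: complex:] = monom (- 1) (Suc 0)"
    by (simp_all add: monom_altdef)
  then show ?thesis
    by (intro poly_eqI) (simp add: coeff_map_poly)
qed

theorem proposition4p3:
  shows "(\<forall>(n::nat) (\<gamma>::real). real n \<le> \<gamma> \<longrightarrow> unitary_poly (G n \<gamma>)) \<and>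
         (\<forall>m::nat.
            (\<forall>\<gamma>::real. real (2 * m) \<le> \<gamma> \<longrightarrow> poly (G (2 * m) \<gamma>) 1 \<noteq> 0) \<and>
            (\<forall>\<gamma>::real. real (2 * m + 1) \<le> \<gamma> \<longrightarrow> poly (G (2 * m + 1) \<gamma>) 1 = 0))"
proof -
  \<comment> \<open>The factor K does not affect roots; x -> -x preserves the unit circle and sends
    1 to -1.\<close>
  have eq: "\<exists>l K. l > 0 \<and> K \<noteq> 0 \<and> G n \<gamma> = pcompose (smult K (gegen l n)) [:0, -1:]"
    if "real n \<le> \<gamma>" for n \<gamma>
  proof (intro exI conjI)
    show "\<gamma> - real n + 1 > 0" using that by simp
    then show "fact n / pochhammer (\<gamma> - real n + 1) n \<noteq> 0"
      using pochhammer_pos[of "\<gamma> - real n + 1" n] by simp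
    show "G n \<gamma> = pcompose (smult (fact n / pochhammer (\<gamma> - real n + 1) n)
        (gegen (\<gamma> - real n + 1) n)) [:0, -1:]"
      unfolding G_def hyp_poly_eq_gegen[OF that] ..
  qed
  have "unitary_poly (G n \<gamma>)" if "real n \<le> \<gamma>" for n \<gamma>
    unfolding unitary_poly_def
  proof (intro allI impI)
    fix z :: complex
    assume root: "poly (map_poly of_real (G n \<gamma>)) z = 0"
    from eq[OF that] obtain l K where l: "l > 0" "K \<noteq> 0"
      and G: "G n \<gamma> = pcompose (smult K (gegen l n)) [:0, -1:]" by blast
    have "poly (gegen (of_real l) n) (- z) = 0"
      using root \<open>K \<noteq> 0\<close>
      by (simp add: G map_poly_pcompose_uminus map_poly_smult map_poly_gegen poly_pcompose)
    from gegen_root_unit[OF \<open>l > 0\<close> this] show "cmod z = 1" by simp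
  qed
  moreover have "poly (G (2 * m) \<gamma>) 1 \<noteq> 0" if "real (2 * m) \<le> \<gamma>" for m \<gamma>
    using eq[OF that] gegen_neg_one by (auto simp: poly_pcompose)
  moreover have "poly (G (2 * m + 1) \<gamma>) 1 = 0" if "real (2 * m + 1) \<le> \<gamma>" for m \<gamma>
    using eq[OF that] gegen_neg_one[of _ m] by (auto simp: poly_pcompose)
  ultimately show ?thesis by blast
qed

end
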